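(* Let $k$ be an algebraically closed field, let $a,b\ge 2$, and let $U\subseteq R_{a,b}=H^0(\mathcal{O}_{\mathbb{P}^1\times\mathbb{P}^1}(a,b))$ be a four-dimensional basepoint free vector space with basis $\{p_0,p_1,p_2,p_3\}$. Suppose there is a linear first syzygy $L$ of bidegree $(0,1)$ on $I_U=\langle p_0,p_1,p_2,p_3\rangle$. Then there are two additional first syzygies $S_1,S_2$ on $I_U$, both of bidegree $(a,b-1)$, such that $$\dim_k \langle L,S_1,S_2\rangle_{(2a-1,b-1)}=2ab .$$
   Context: $R=k[s,t,u,v]$ is bigraded with $s,t$ of bidegree $(1,0)$ and $u,v$ of bidegree $(0,1)$; $R_{a,b}$ denotes the bidegree $(a,b)$ graded piece, identified with $H^0(\mathcal{O}_{\mathbb{P}^1\times\mathbb{P}^1}(a,b))$. $U$ is basepoint free if $p_0,\dots,p_3$ have no common zero on $\mathbb{P}^1\times\mathbb{P}^1$. First syzygies are elements of $\mathrm{Syz}(I_U)=\{(g_0,g_1,g_2,g_3)\in R^4 : \sum_{i=0}^3 g_ip_i=0\}$. A first syzygy has bidegree $(c,d)$ if all its entries $g_i$ lie in $R_{c,d}$. A linear first syzygy of bidegree $(0,1)$ is a nonzero first syzygy of bidegree $(0,1)$. $\langle L,S_1,S_2\rangle$ denotes the $R$-submodule of $\mathrm{Syz}(I_U)\subseteq R^4$ generated by $L,S_1,S_2$, and $\langle L,S_1,S_2\rangle_{(c,d)}$ is the $k$-vector space of its elements all of whose entries lie in $R_{c,d}$. *)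

theory Defs
  imports
    "HOL-Analysis.Finite_Cartesian_Product"
    "HOL-Computational_Algebra.Polynomial"
    "HOL-Library.Poly_Mapping"
begin

text \<open>A monomial \<open>s^i t^j u^k v^l\<close> is its exponent map, and the bigraded ring
  \<open>R = k[s,t,u,v]\<close> is the monoid algebra of finitely supported maps from monomials to \<open>k\<close>.\<close>

datatype var = Var_s | Var_t | Var_u | Var_v

type_synonym monomial = "var \<Rightarrow>\<^sub>0 nat"
type_synonym 'k bipoly = "monomial \<Rightarrow>\<^sub>0 'k"

definition bigraded_piece :: "nat \<Rightarrow> nat \<Rightarrow> 'k::zero bipoly set" where
  "bigraded_piece c d = {f. \<forall>m \<in> Poly_Mapping.keys f.
      Poly_Mapping.lookup m Var_s + Poly_Mapping.lookup m Var_t = c \<and>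
      Poly_Mapping.lookup m Var_u + Poly_Mapping.lookup m Var_v = d}"

definition eval_bipoly :: "'k::comm_semiring_1 bipoly \<Rightarrow> 'k \<Rightarrow> 'k \<Rightarrow> 'k \<Rightarrow> 'k \<Rightarrow> 'k" where
  "eval_bipoly f s t u v = (\<Sum>m \<in> Poly_Mapping.keys f. Poly_Mapping.lookup f m *
      (s ^ Poly_Mapping.lookup m Var_s * t ^ Poly_Mapping.lookup m Var_t *
       u ^ Poly_Mapping.lookup m Var_u * v ^ Poly_Mapping.lookup m Var_v))"

text \<open>Points of \<open>P^1 \<times> P^1\<close> over \<open>k\<close> are given by bihomogeneous coordinates \<open>(s : t), (u : v)\<close>;
  vanishing of bihomogeneous polynomials does not depend on the representatives. The index type
  \<open>4\<close> has the elements \<open>0, 1, 2, 3\<close>.\<close>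

definition basepoint_free :: "'k::comm_semiring_1 bipoly ^ 4 \<Rightarrow> bool" where
  "basepoint_free p \<longleftrightarrow> \<not> (\<exists>s t u v. (s, t) \<noteq> (0, 0) \<and> (u, v) \<noteq> (0, 0) \<and>
      (\<forall>i. eval_bipoly (p $ i) s t u v = 0))"

definition const_bipoly :: "'k::zero \<Rightarrow> 'k bipoly" where
  "const_bipoly c = Poly_Mapping.single 0 c"

lemma const_bipoly_simps:
  "const_bipoly (a + b) = const_bipoly a + const_bipoly (b::'k::comm_ring_1)"
  "const_bipoly (a * b) = const_bipoly a * const_bipoly (b::'k::comm_ring_1)"
  "const_bipoly (1::'k::comm_ring_1) = 1"
  by (simp_all add: const_bipoly_def single_add mult_single)

definition kscale :: "'k::comm_ring_1 \<Rightarrow> 'k bipoly \<Rightarrow> 'k bipoly" where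
  "kscale c f = const_bipoly c * f"

definition kscale4 :: "'k::comm_ring_1 \<Rightarrow> 'k bipoly ^ 4 \<Rightarrow> 'k bipoly ^ 4" where
  "kscale4 c g = const_bipoly c *s g"

global_interpretation k_R: vector_space "kscale :: 'k::field \<Rightarrow> _"
  by unfold_locales (simp_all add: kscale_def const_bipoly_simps algebra_simps)

global_interpretation k_R4: vector_space "kscale4 :: 'k::field \<Rightarrow> _"
  by unfold_locales
    (simp_all add: kscale4_def const_bipoly_simps vec_eq_iff algebra_simps)

global_interpretation R_R4: module "(*s) :: 'k::comm_ring_1 bipoly \<Rightarrow> 'k bipoly ^ 4 \<Rightarrow> _"
  by unfold_locales (simp_all add: vec_eq_iff algebra_simps)

definition Syz :: "'k::comm_ring_1 bipoly ^ 4 \<Rightarrow> ('k bipoly ^ 4) set" where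
  "Syz p = {g. (\<Sum>i\<in>UNIV. g $ i * p $ i) = 0}"

definition has_bidegree :: "'k::zero bipoly ^ 4 \<Rightarrow> nat \<Rightarrow> nat \<Rightarrow> bool" where
  "has_bidegree g c d \<longleftrightarrow> (\<forall>i. g $ i \<in> bigraded_piece c d)"

end

theory Submission
  imports Defs
begin

text \<open>
  Write \<open>L = u A + v B\<close> with \<open>A, B \<in> k^4\<close>. Linear independence of the \<open>p_i\<close> forces \<open>A\<close> and \<open>B\<close> to
  be linearly independent. The relation \<open>u (A \<bullet> p) + v (B \<bullet> p) = 0\<close> is a syzygy on \<open>u, v\<close>, so
  there is a form \<open>h\<close> of bidegree \<open>(a, b - 1)\<close> with \<open>A \<bullet> p = v h\<close> and \<open>B \<bullet> p = - u h\<close>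
  (\<open>syzygy_u_v\<close>). In other words, after a change of basis of \<open>U\<close> two of the generators are \<open>v h\<close> and
  \<open>- u h\<close>. As \<open>b > 0\<close>, every \<open>p_i\<close> lies in the ideal of \<open>u, v\<close>, say \<open>p_i = u \<alpha>_i + v \<beta>_i\<close>
  (\<open>decompose_u_v\<close>), and then \<open>h p_i = \<beta>_i (v h) + \<alpha>_i (u h)\<close> turns into the syzygy

  \<open>S_i = h e_i - \<beta>_i A + \<alpha>_i B\<close>

  of bidegree \<open>(a, b - 1)\<close>. It is the Koszul relation between \<open>h\<close> and \<open>p_i\<close>, rewritten in terms of
  the generators.

  Choose \<open>i, j\<close> so that \<open>A, B, e_i, e_j\<close> is a basis of \<open>k^4\<close>; in this basis
  \<open>L = (u, v, 0, 0)\<close>, \<open>S_i = (*, *, h, 0)\<close> and \<open>S_j = (*, *, 0, h)\<close>. Since the polynomial ring is a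
  domain and \<open>h \<noteq> 0\<close>, the three syzygies generate a free submodule (\<open>free_syzygies\<close>). The
  graded pieces of a free graded module are counted by monomials (\<open>dim_graded_piece_free\<close>): here the
  coefficients of \<open>L, S_i, S_j\<close> have bidegrees \<open>(2a - 1, b - 2)\<close>, \<open>(a - 1, 0)\<close>, \<open>(a - 1, 0)\<close>, so the
  dimension is \<open>2a(b - 1) + a + a = 2ab\<close>.
\<close>

section \<open>The polynomial ring is a domain\<close>

text \<open>Any linear order on the variables will do: it induces a monomial order, and comparing leading
  terms shows that \<open>k[s,t,u,v]\<close> has no zero divisors. This makes the type \<open>bipoly\<close> an instance of
  the class \<open>idom\<close>.\<close>

instantiation var :: linorder
begin

definition less_eq_var :: "var \<Rightarrow> var \<Rightarrow> bool" where
  "x \<le> y \<longleftrightarrow> case_var 0 1 2 (3::nat) x \<le> case_var 0 1 2 3 y"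

definition less_var :: "var \<Rightarrow> var \<Rightarrow> bool" where
  "x < y \<longleftrightarrow> case_var 0 1 2 (3::nat) x < case_var 0 1 2 3 y"

instance
  by standard (auto simp: less_eq_var_def less_var_def split: var.splits)

end

section \<open>Bidegrees\<close>

definition bideg :: "monomial \<Rightarrow> nat \<times> nat" where
  "bideg m = (Poly_Mapping.lookup m Var_s + Poly_Mapping.lookup m Var_t,
     Poly_Mapping.lookup m Var_u + Poly_Mapping.lookup m Var_v)"

lemma bideg_add: "bideg (m + n) = (fst (bideg m) + fst (bideg n), snd (bideg m) + snd (bideg n))"
  by (simp add: bideg_def lookup_add)

lemma bigraded_piece_iff:
  "f \<in> bigraded_piece c d \<longleftrightarrow> (\<forall>m\<in>Poly_Mapping.keys f. bideg m = (c, d))"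
  by (simp add: bigraded_piece_def bideg_def)

lemma bigraded_piece_0 [simp]: "0 \<in> bigraded_piece c d"
  by (simp add: bigraded_piece_iff)

lemma bigraded_piece_add:
  "f \<in> bigraded_piece c d \<Longrightarrow> g \<in> bigraded_piece c d \<Longrightarrow> f + g \<in> bigraded_piece c d"
  using keys_add[of f g] unfolding bigraded_piece_iff by blast

lemma bigraded_piece_diff:
  "f \<in> bigraded_piece c d \<Longrightarrow> g \<in> bigraded_piece c d \<Longrightarrow> f - g \<in> bigraded_piece c d"
  for f g :: "'k::ab_group_add bipoly"
  using keys_diff[of f g] unfolding bigraded_piece_iff by blast

lemma bigraded_piece_sum:
  assumes "\<And>i. i \<in> I \<Longrightarrow> f i \<in> bigraded_piece c d"
  shows "(\<Sum>i\<in>I. f i) \<in> bigraded_piece c d"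
  using assms by (induction I rule: infinite_finite_induct) (auto intro: bigraded_piece_add)

lemma bigraded_piece_mult:
  assumes "f \<in> bigraded_piece c d" "g \<in> bigraded_piece c' d'"
  shows "f * g \<in> bigraded_piece (c + c') (d + d')"
  using keys_mult[of f g] assms unfolding bigraded_piece_iff by (fastforce simp: bideg_add)

lemma bigraded_piece_single: "bideg m = (c, d) \<Longrightarrow> Poly_Mapping.single m x \<in> bigraded_piece c d"
  by (simp add: bigraded_piece_iff)

lemma const_in_bigraded_piece: "const_bipoly x \<in> bigraded_piece 0 0"
  unfolding const_bipoly_def by (rule bigraded_piece_single) (simp add: bideg_def)

lemma bigraded_piece_0_0D:
  assumes "f \<in> bigraded_piece 0 0"
  obtains x where "f = const_bipoly x"
proof -
  have "m = 0" if "bideg m = (0, 0)" for m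
  proof (rule poly_mapping_eqI)
    fix w show "Poly_Mapping.lookup m w = Poly_Mapping.lookup 0 w"
      using that by (cases w) (auto simp: bideg_def)
  qed
  then have "Poly_Mapping.keys f \<subseteq> {0}"
    using assms by (auto simp: bigraded_piece_iff)
  then have "f = const_bipoly (Poly_Mapping.lookup f 0)"
    unfolding const_bipoly_def
    by (intro poly_mapping_eqI) (auto simp: lookup_single when_def in_keys_iff)
  then show thesis by (rule that)
qed

lemma sum_single_keys:
  assumes "finite M" "Poly_Mapping.keys f \<subseteq> M"
  shows "(\<Sum>m\<in>M. Poly_Mapping.single m (Poly_Mapping.lookup f m)) = f"
  by (rule poly_mapping_eqI)
    (use assms in \<open>auto simp: lookup_sum lookup_single when_def sum.delta' in_keys_iff\<close>)

lemma split_keys: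
  fixes f :: "'a \<Rightarrow>\<^sub>0 'b::ab_group_add"
  obtains g h where "f = g + h" "Poly_Mapping.keys g \<subseteq> P" "Poly_Mapping.keys h \<subseteq> Poly_Mapping.keys f - P"
proof -
  let ?g = "\<lambda>A. \<Sum>m\<in>A. Poly_Mapping.single m (Poly_Mapping.lookup f m)"
  have "Poly_Mapping.keys (?g A) \<subseteq> A" for A
    using keys_sum[of "\<lambda>m. Poly_Mapping.single m (Poly_Mapping.lookup f m)" A]
    by (auto split: if_splits)
  moreover have "f = ?g (Poly_Mapping.keys f \<inter> P) + ?g (Poly_Mapping.keys f - P)"
    using sum_single_keys[of "Poly_Mapping.keys f" f]
    by (metis sum.Int_Diff finite_keys order_refl)
  ultimately show thesis using that by (meson Int_lower2 order_trans)
qed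

lemma sum_zero_disjoint_keys:
  fixes f :: "'a \<Rightarrow>\<^sub>0 'b::ab_group_add"
  assumes "f + g = 0" "Poly_Mapping.keys f \<inter> Poly_Mapping.keys g = {}"
  shows "f = 0" "g = 0"
proof -
  have "f = - g" using assms(1) by (simp add: eq_neg_iff_add_eq_0)
  then show "f = 0" "g = 0" using assms(2) by auto
qed

section \<open>Syzygies on two variables\<close>

abbreviation X :: "var \<Rightarrow> 'k::comm_ring_1 bipoly" where
  "X w \<equiv> Poly_Mapping.single (Poly_Mapping.single w 1) 1"

lemma single_one_neq_0 [simp]: "Poly_Mapping.single m (1 :: 'b::zero_neq_one) \<noteq> 0"
  by (metis lookup_single_eq lookup_zero one_neq_zero)

text \<open>The control over the monomials of the quotient is what transfers bidegrees, and the absence of a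
  second variable, from \<open>f\<close> to \<open>g\<close>.\<close>

lemma divisible_by_X:
  fixes f :: "'k::comm_ring_1 bipoly"
  assumes "\<And>m. m \<in> Poly_Mapping.keys f \<Longrightarrow> Poly_Mapping.lookup m w \<noteq> 0"
  obtains g where "f = X w * g"
    "\<And>n. n \<in> Poly_Mapping.keys g \<Longrightarrow> Poly_Mapping.single w 1 + n \<in> Poly_Mapping.keys f"
proof -
  let ?e = "Poly_Mapping.single w (1::nat)"
  have *: "?e + (m - ?e) = m" if "m \<in> Poly_Mapping.keys f" for m
    using assms[OF that]
    by (intro poly_mapping_eqI) (auto simp: lookup_add lookup_minus lookup_single when_def)
  let ?g = "\<Sum>m\<in>Poly_Mapping.keys f. Poly_Mapping.single (m - ?e) (Poly_Mapping.lookup f m)"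
  have "X w * ?g = (\<Sum>m\<in>Poly_Mapping.keys f. Poly_Mapping.single m (Poly_Mapping.lookup f m))"
    unfolding sum_distrib_left by (intro sum.cong refl) (simp only: mult_single * mult_1_left)
  also have "\<dots> = f" by (rule sum_single_keys) auto
  finally have "f = X w * ?g" by simp
  moreover have "?e + n \<in> Poly_Mapping.keys f" if n: "n \<in> Poly_Mapping.keys ?g" for n
  proof -
    obtain m where "m \<in> Poly_Mapping.keys f" "n = m - ?e"
      using n keys_sum[of "\<lambda>m. Poly_Mapping.single (m - ?e) (Poly_Mapping.lookup f m)" "Poly_Mapping.keys f"]
      by (auto split: if_splits)
    then show ?thesis using * by auto
  qed
  ultimately show thesis by (rule that)
qed

lemma bidegree_of_quotient:
  assumes "snd (bideg e) = 1" "fst (bideg e) = 0" "bideg (e + n) = (c, Suc d)"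
  shows "bideg n = (c, d)"
  using assms by (simp add: bideg_add prod_eq_iff)

text \<open>Each monomial of positive degree in \<open>u, v\<close> is divisible by \<open>u\<close> or by \<open>v\<close>. Giving all
  multiples of \<open>v\<close> to \<open>\<beta>\<close> keeps \<open>\<alpha>\<close> free of \<open>v\<close>; this normal form is what makes
  \<open>syzygy_u_v\<close> a comparison of monomials.\<close>

lemma decompose_u_v:
  fixes f :: "'k::comm_ring_1 bipoly"
  assumes "f \<in> bigraded_piece c (Suc d)"
  obtains \<alpha> \<beta> where "f = X Var_u * \<alpha> + X Var_v * \<beta>"
    "\<alpha> \<in> bigraded_piece c d" "\<beta> \<in> bigraded_piece c d"
    "\<And>m. m \<in> Poly_Mapping.keys \<alpha> \<Longrightarrow> Poly_Mapping.lookup m Var_v = 0"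
proof -
  obtain g h where fgh: "f = g + h"
    and g: "Poly_Mapping.keys g \<subseteq> {m. Poly_Mapping.lookup m Var_v \<noteq> 0} \<inter> Poly_Mapping.keys f"
    and h: "Poly_Mapping.keys h \<subseteq> Poly_Mapping.keys f -
      ({m. Poly_Mapping.lookup m Var_v \<noteq> 0} \<inter> Poly_Mapping.keys f)"
    by (rule split_keys)
  have v: "snd (bideg (Poly_Mapping.single Var_v 1)) = 1" "fst (bideg (Poly_Mapping.single Var_v 1)) = 0"
    and u: "snd (bideg (Poly_Mapping.single Var_u 1)) = 1" "fst (bideg (Poly_Mapping.single Var_u 1)) = 0"
    by (simp_all add: bideg_def lookup_single)
  obtain \<beta> where \<beta>: "g = X Var_v * \<beta>"
    "\<And>n. n \<in> Poly_Mapping.keys \<beta> \<Longrightarrow> Poly_Mapping.single Var_v 1 + n \<in> Poly_Mapping.keys g"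
    using g by (rule_tac divisible_by_X[of g Var_v]) auto
  have hf: "m \<in> Poly_Mapping.keys f" "Poly_Mapping.lookup m Var_v = 0" if "m \<in> Poly_Mapping.keys h" for m
    using h that by auto
  have "Poly_Mapping.lookup m Var_u \<noteq> 0" if "m \<in> Poly_Mapping.keys h" for m
    using hf[OF that] assms by (auto simp: bigraded_piece_def)
  then obtain \<alpha> where \<alpha>: "h = X Var_u * \<alpha>"
    "\<And>n. n \<in> Poly_Mapping.keys \<alpha> \<Longrightarrow> Poly_Mapping.single Var_u 1 + n \<in> Poly_Mapping.keys h"
    using divisible_by_X[of h Var_u] by blast
  show thesis
  proof (rule that)
    show "f = X Var_u * \<alpha> + X Var_v * \<beta>" using fgh \<alpha>(1) \<beta>(1) by (simp add: add.commute)
    show "\<alpha> \<in> bigraded_piece c d"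
      using \<alpha>(2) hf(1) assms bidegree_of_quotient[OF u] unfolding bigraded_piece_iff by blast
    show "\<beta> \<in> bigraded_piece c d"
      using \<beta>(2) g assms bidegree_of_quotient[OF v] unfolding bigraded_piece_iff by blast
    show "Poly_Mapping.lookup m Var_v = 0" if "m \<in> Poly_Mapping.keys \<alpha>" for m
      using hf(2)[OF \<alpha>(2)[OF that]] by (simp add: lookup_add)
  qed
qed

text \<open>The syzygies on \<open>u, v\<close> are the multiples of \<open>(v, - u)\<close>. With \<open>q = u \<alpha> + v \<beta>\<close> in normal
  form, the relation becomes \<open>u u \<alpha> + v (u \<beta> + r) = 0\<close>, where the first term has no monomial
  containing \<open>v\<close> and the second has only such monomials; so both terms vanish.\<close>

lemma syzygy_u_v:
  fixes q r :: "'k::idom bipoly"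
  assumes q: "q \<in> bigraded_piece c (Suc d)" and syz: "X Var_u * q + X Var_v * r = 0"
  obtains h where "q = X Var_v * h" "r = - (X Var_u * h)" "h \<in> bigraded_piece c d"
proof -
  let ?u = "X Var_u :: 'k bipoly" and ?v = "X Var_v :: 'k bipoly"
  obtain \<alpha> \<beta> where q_eq: "q = ?u * \<alpha> + ?v * \<beta>" and \<beta>: "\<beta> \<in> bigraded_piece c d"
    and \<alpha>: "\<And>m. m \<in> Poly_Mapping.keys \<alpha> \<Longrightarrow> Poly_Mapping.lookup m Var_v = 0"
    using q by (rule decompose_u_v) blast
  have "?u * (?u * \<alpha>) + ?v * (?u * \<beta> + r) = 0"
    using syz unfolding q_eq by (simp add: algebra_simps)
  moreover have "Poly_Mapping.lookup m Var_v = 0" if m: "m \<in> Poly_Mapping.keys (?u * (?u * \<alpha>))" for m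
  proof -
    obtain n where "n \<in> Poly_Mapping.keys \<alpha>"
      "m = Poly_Mapping.single Var_u 1 + (Poly_Mapping.single Var_u 1 + n)"
      using m keys_mult[of ?u "?u * \<alpha>"] keys_mult[of ?u \<alpha>] by fastforce
    then show ?thesis using \<alpha> by (simp add: lookup_add lookup_single)
  qed
  moreover have "Poly_Mapping.lookup m Var_v \<noteq> 0"
    if m: "m \<in> Poly_Mapping.keys (?v * (?u * \<beta> + r))" for m
  proof -
    obtain n where "m = Poly_Mapping.single Var_v 1 + n"
      using m keys_mult[of ?v "?u * \<beta> + r"] by fastforce
    then show ?thesis by (simp add: lookup_add)
  qed
  ultimately have "?u * (?u * \<alpha>) = 0" "?v * (?u * \<beta> + r) = 0"
    using sum_zero_disjoint_keys by blast+
  then have "\<alpha> = 0" "r = - (?u * \<beta>)" by (auto simp: eq_neg_iff_add_eq_0 add.commute)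
  then show thesis using that[of \<beta>] q_eq \<beta> by simp
qed

section \<open>Graded pieces of free submodules\<close>

lemma finite_monomials: "finite {m. bideg m = (c, d)}"
  and card_monomials: "card {m. bideg m = (c, d)} = (c + 1) * (d + 1)"
proof -
  define mono where "mono = (\<lambda>(i, j). Poly_Mapping.single Var_s i + Poly_Mapping.single Var_t (c - i) +
    Poly_Mapping.single Var_u j + Poly_Mapping.single Var_v (d - j) :: monomial)"
  \<comment> \<open>A monomial of given bidegree is determined by its exponents of \<open>s\<close> and \<open>u\<close>.\<close>
  have "bij_betw mono ({..c} \<times> {..d}) {m. bideg m = (c, d)}"
  proof (rule bij_betw_byWitness[where f' = "\<lambda>m. (Poly_Mapping.lookup m Var_s, Poly_Mapping.lookup m Var_u)"])
    show "\<forall>m\<in>{m. bideg m = (c, d)}.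
        mono (Poly_Mapping.lookup m Var_s, Poly_Mapping.lookup m Var_u) = m"
    proof (intro ballI poly_mapping_eqI)
      fix m w assume "m \<in> {m. bideg m = (c, d)}"
      then show "Poly_Mapping.lookup (mono (Poly_Mapping.lookup m Var_s, Poly_Mapping.lookup m Var_u)) w
          = Poly_Mapping.lookup m w"
        by (cases w) (auto simp: mono_def bideg_def lookup_add lookup_single)
    qed
  qed (auto simp: mono_def bideg_def lookup_add lookup_single)
  then show "finite {m. bideg m = (c, d)}" "card {m. bideg m = (c, d)} = (c + 1) * (d + 1)"
    by (auto dest: bij_betw_finite bij_betw_same_card)
qed

lemma (in vector_space) dim_span_family:
  assumes fin: "finite I"
    and indep: "\<And>c i. (\<Sum>i\<in>I. scale (c i) (f i)) = 0 \<Longrightarrow> i \<in> I \<Longrightarrow> c i = 0"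
  shows "dim (span (f ` I)) = card I"
proof -
  have inj: "inj_on f I"
  proof (rule inj_onI, rule ccontr)
    fix i j assume ij: "i \<in> I" "j \<in> I" "f i = f j" "i \<noteq> j"
    have "(\<Sum>l\<in>I. scale (if l = i then 1 else if l = j then - 1 else 0) (f l)) =
        (\<Sum>l\<in>I. (if l = i then f i else 0) - (if l = j then f i else 0))"
      using ij by (intro sum.cong) auto
    also have "\<dots> = 0" using ij fin by (simp add: sum_subtractf)
    finally show False using indep[of _ i] ij by fastforce
  qed
  have "independent (f ` I)"
  proof (rule independent_if_scalars_zero)
    fix c x assume "(\<Sum>x\<in>f ` I. scale (c x) x) = 0" and "x \<in> f ` I"
    then show "c x = 0"
      using indep[of "\<lambda>i. c (f i)"] by (auto simp: sum.reindex[OF inj])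
  qed (use fin in simp)
  then show ?thesis by (simp add: dim_span_eq_card_independent card_image[OF inj] del: dim_span)
qed

text \<open>Coefficients of a homogeneous element can be taken homogeneous: split each coefficient \<open>z G\<close>
  into its part \<open>x G\<close> of the expected bidegree and a rest \<open>y G\<close>. In each coordinate, the combination
  with the \<open>y G\<close> has no monomial of bidegree \<open>(c, d)\<close>, yet it is the difference of two elements of
  that bidegree, so it is zero.\<close>

lemma homogeneous_in_span:
  fixes F :: "('k::comm_ring_1 bipoly ^ 4) set"
  assumes fin: "finite F" and deg: "\<And>G. G \<in> F \<Longrightarrow> has_bidegree G (cd G) (dd G)"
    and le: "\<And>G. G \<in> F \<Longrightarrow> cd G \<le> c \<and> dd G \<le> d"
    and g: "g \<in> R_R4.span F" "has_bidegree g c d"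
  obtains x where "g = (\<Sum>G\<in>F. x G *s G)"
    "\<And>G. G \<in> F \<Longrightarrow> x G \<in> bigraded_piece (c - cd G) (d - dd G)"
proof -
  obtain z where z: "g = (\<Sum>G\<in>F. z G *s G)"
    using g(1) unfolding R_R4.span_finite[OF fin] by blast
  have "\<exists>x y. z G = x + y \<and> x \<in> bigraded_piece (c - cd G) (d - dd G) \<and>
      (\<forall>m\<in>Poly_Mapping.keys y. bideg m \<noteq> (c - cd G, d - dd G))" for G
    by (rule split_keys[of "z G" "{m. bideg m = (c - cd G, d - dd G)}"])
      (auto simp: bigraded_piece_iff)
  then obtain x y where xy: "\<And>G. z G = x G + y G"
    and x: "\<And>G. x G \<in> bigraded_piece (c - cd G) (d - dd G)"
    and y: "\<And>G m. m \<in> Poly_Mapping.keys (y G) \<Longrightarrow> bideg m \<noteq> (c - cd G, d - dd G)"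
    by metis
  have "(\<Sum>G\<in>F. y G * G $ i) = 0" for i
  proof -
    let ?r = "(\<Sum>G\<in>F. x G * G $ i) - g $ i" and ?s = "\<Sum>G\<in>F. y G * G $ i"
    have "g $ i = (\<Sum>G\<in>F. x G * G $ i) + ?s"
      by (simp add: z xy sum.distrib distrib_right)
    then have "?r + ?s = 0" by simp
    moreover have "?r \<in> bigraded_piece c d"
    proof -
      have "x G * G $ i \<in> bigraded_piece c d" if "G \<in> F" for G
        using bigraded_piece_mult[OF x, of "G $ i" "cd G" "dd G" G] deg[OF that] le[OF that]
        by (simp add: has_bidegree_def)
      then show ?thesis
        using g(2) by (auto simp: has_bidegree_def intro!: bigraded_piece_diff bigraded_piece_sum)
    qed
    moreover have "bideg m \<noteq> (c, d)" if m: "m \<in> Poly_Mapping.keys ?s" for m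
    proof -
      obtain G where G: "G \<in> F" "m \<in> Poly_Mapping.keys (y G * G $ i)"
        using m keys_sum[of "\<lambda>G. y G * G $ i" F] by blast
      then obtain n n' where "m = n + n'" "n \<in> Poly_Mapping.keys (y G)" "n' \<in> Poly_Mapping.keys (G $ i)"
        using keys_mult[of "y G" "G $ i"] by blast
      moreover from this have "bideg n' = (cd G, dd G)"
        using deg[OF G(1)] by (auto simp: has_bidegree_def bigraded_piece_iff)
      ultimately show ?thesis using y[of n G] le[OF G(1)] by (auto simp: bideg_add prod_eq_iff)
    qed
    ultimately show ?thesis
      using sum_zero_disjoint_keys(2)[of ?r ?s] unfolding bigraded_piece_iff by blast
  qed
  then have "g = (\<Sum>G\<in>F. x G *s G)"
    by (simp add: vec_eq_iff z xy sum.distrib distrib_right)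
  then show thesis using x by (rule that)
qed

text \<open>The elements \<open>m G\<close>, with \<open>G \<in> F\<close> and \<open>m\<close> a monomial of the bidegree complementary to that
  of \<open>G\<close>, form a \<open>k\<close>-basis: they span by \<open>homogeneous_in_span\<close> and are independent because
  \<open>F\<close> is free over the polynomial ring.\<close>

lemma dim_graded_piece_free:
  fixes F :: "('k::field bipoly ^ 4) set"
  assumes fin: "finite F" and deg: "\<And>G. G \<in> F \<Longrightarrow> has_bidegree G (cd G) (dd G)"
    and le: "\<And>G. G \<in> F \<Longrightarrow> cd G \<le> c \<and> dd G \<le> d"
    and free: "R_R4.independent F"
  shows "k_R4.dim {g \<in> R_R4.span F. has_bidegree g c d} =
    (\<Sum>G\<in>F. (c - cd G + 1) * (d - dd G + 1))"
proof -
  let ?M = "\<lambda>G. {m. bideg m = (c - cd G, d - dd G)}"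
  let ?I = "Sigma F ?M"
  let ?f = "\<lambda>(G, m). Poly_Mapping.single m 1 *s G :: 'k bipoly ^ 4"
  let ?W = "{g \<in> R_R4.span F. has_bidegree g c d}"
  have finI: "finite ?I" using fin finite_monomials by auto
  have scale: "kscale4 r (?f (G, m)) = Poly_Mapping.single m r *s G" for r G m
    by (simp add: kscale4_def const_bipoly_def mult_single)
  have comb: "(\<Sum>i\<in>?I. kscale4 (r i) (?f i)) = (\<Sum>G\<in>F. (\<Sum>m\<in>?M G. Poly_Mapping.single m (r (G, m))) *s G)"
    for r
  proof -
    have "(\<Sum>i\<in>?I. kscale4 (r i) (?f i)) = (\<Sum>(G, m)\<in>?I. Poly_Mapping.single m (r (G, m)) *s G)"
      by (rule sum.cong) (use scale in auto)
    also have "\<dots> = (\<Sum>G\<in>F. \<Sum>m\<in>?M G. Poly_Mapping.single m (r (G, m)) *s G)"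
      using fin finite_monomials by (subst sum.Sigma) auto
    finally show ?thesis by (simp add: R_R4.scale_sum_left)
  qed
  have "?W = k_R4.span (?f ` ?I)"
  proof (intro equalityI subsetI)
    fix g assume "g \<in> ?W"
    then obtain x where g: "g = (\<Sum>G\<in>F. x G *s G)"
      and x: "\<And>G. G \<in> F \<Longrightarrow> x G \<in> bigraded_piece (c - cd G) (d - dd G)"
      using homogeneous_in_span[OF fin deg le] by blast
    have "g = (\<Sum>i\<in>?I. kscale4 (case i of (G, m) \<Rightarrow> Poly_Mapping.lookup (x G) m) (?f i))"
      unfolding comb g
      using x by (intro sum.cong refl)
        (auto simp: bigraded_piece_iff intro!: sum_single_keys[symmetric] finite_monomials arg_cong2[where f="(*s)"])
    then show "g \<in> k_R4.span (?f ` ?I)"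
      by (simp only:) (intro k_R4.span_sum k_R4.span_scale k_R4.span_base imageI)
  next
    have "k_R4.subspace ?W"
    proof (rule k_R4.subspaceI)
      show "x + y \<in> ?W" if "x \<in> ?W" "y \<in> ?W" for x y
        using that by (auto simp: has_bidegree_def intro: R_R4.span_add bigraded_piece_add)
      show "kscale4 r x \<in> ?W" if "x \<in> ?W" for r x
        using that bigraded_piece_mult[OF const_in_bigraded_piece]
        by (fastforce simp: kscale4_def has_bidegree_def intro: R_R4.span_scale)
    qed (auto simp: has_bidegree_def R_R4.span_zero)
    moreover have "?f ` ?I \<subseteq> ?W"
    proof (rule image_subsetI)
      fix i assume "i \<in> ?I"
      then obtain G m where i: "i = (G, m)" and G: "G \<in> F" and m: "bideg m = (c - cd G, d - dd G)"
        by auto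
      have "has_bidegree (?f (G, m)) c d"
        using bigraded_piece_mult[OF bigraded_piece_single[OF m]] deg[OF G] le[OF G]
        by (fastforce simp: has_bidegree_def)
      then show "?f i \<in> ?W"
        using G i by (auto intro: R_R4.span_scale R_R4.span_base)
    qed
    moreover fix g assume "g \<in> k_R4.span (?f ` ?I)"
    ultimately show "g \<in> ?W" using k_R4.span_minimal by blast
  qed
  then have "k_R4.dim ?W = k_R4.dim (k_R4.span (?f ` ?I))" by simp
  also have "\<dots> = card ?I"
  proof (rule k_R4.dim_span_family[OF finI])
    fix r i assume "(\<Sum>i\<in>?I. kscale4 (r i) (?f i)) = 0" and i: "i \<in> ?I"
    then have "(\<Sum>m\<in>?M (fst i). Poly_Mapping.single m (r (fst i, m))) = 0"
      unfolding comb using R_R4.independentD[OF free fin subset_refl] by auto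
    then have "Poly_Mapping.lookup (\<Sum>m\<in>?M (fst i). Poly_Mapping.single m (r (fst i, m))) (snd i) = 0"
      by simp
    then show "r i = 0"
      using i by (cases i) (simp add: lookup_sum lookup_single when_def finite_monomials)
  qed
  also have "\<dots> = (\<Sum>G\<in>F. (c - cd G + 1) * (d - dd G + 1))"
    using fin by (simp add: card_SigmaI finite_monomials card_monomials del: mult_Suc mult_Suc_right)
  finally show ?thesis .
qed

section \<open>Construction of the two syzygies\<close>

lemma const_combination_zero:
  fixes p :: "'k::field bipoly ^ 4"
  assumes "inj (($) p)" "k_R.independent (range (($) p))"
    and "(\<Sum>i\<in>UNIV. const_bipoly (A i) * p $ i) = 0"
  shows "A i = 0"
proof -
  have "(\<Sum>x\<in>range (($) p). kscale (A (inv (($) p) x)) x) = 0"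
    using assms(1,3) by (simp add: sum.reindex kscale_def)
  then have "A (inv (($) p) (p $ i)) = 0"
    using k_R.independentD[OF assms(2), of "range (($) p)" "\<lambda>x. A (inv (($) p) x)" "p $ i"] by simp
  then show ?thesis using assms(1) by simp
qed

lemma const_bipoly_eq_0_iff [simp]: "const_bipoly x = 0 \<longleftrightarrow> x = (0::'k::comm_ring_1)"
  by (metis const_bipoly_def lookup_single_eq lookup_zero single_zero)

text \<open>The combination equals \<open>P A + Q B + y h e_i + z h e_j\<close> with \<open>P\<close>, \<open>Q\<close> as in the proof. In the
  coordinates \<open>k, l\<close> only \<open>P A + Q B\<close> is visible, and Cramer's rule for the nonzero minor gives
  \<open>P = Q = 0\<close>; the coordinates \<open>i, j\<close> then give \<open>y = z = 0\<close>. This avoids an explicit change of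
  basis.\<close>

lemma free_syzygies:
  fixes A B :: "4 \<Rightarrow> 'r::idom" and h u v :: 'r
  assumes ne: "k \<noteq> l" "i \<noteq> j" "UNIV - {k, l} = {i, j}"
    and minor: "A k * B l \<noteq> A l * B k" and h: "h \<noteq> 0" and u: "u \<noteq> 0"
    and eq: "\<And>n. x * (A n * u + B n * v)
      + y * ((if n = i then h else 0) - \<beta> i * A n + \<alpha> i * B n)
      + z * ((if n = j then h else 0) - \<beta> j * A n + \<alpha> j * B n) = 0"
  shows "x = 0 \<and> y = 0 \<and> z = 0"
proof -
  define P where "P = x * u - y * \<beta> i - z * \<beta> j"
  define Q where "Q = x * v + y * \<alpha> i + z * \<alpha> j"
  have eq': "P * A n + Q * B n + (if n = i then y * h else 0) + (if n = j then z * h else 0) = 0" for n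
    using eq[of n] unfolding P_def Q_def by (auto simp: algebra_simps)
  have kl: "k \<noteq> i" "k \<noteq> j" "l \<noteq> i" "l \<noteq> j" using ne(3) by auto
  have k: "P * A k + Q * B k = 0" and l: "P * A l + Q * B l = 0"
    using eq'[of k] eq'[of l] kl by simp_all
  have "P * (A k * B l - A l * B k) = (P * A k + Q * B k) * B l - (P * A l + Q * B l) * B k"
    "Q * (A k * B l - A l * B k) = (P * A l + Q * B l) * A k - (P * A k + Q * B k) * A l"
    by (simp_all add: algebra_simps)
  then have PQ: "P = 0" "Q = 0" using minor k l by auto
  then have "y = 0" "z = 0" using eq'[of i] eq'[of j] ne h by auto
  moreover from this have "x = 0" using PQ(1) u unfolding P_def by simp
  ultimately show ?thesis by simp
qed

theorem theorem2p2:
  fixes a b :: nat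
    and U :: "'k::alg_closed_field bipoly set"
    and p L :: "'k bipoly ^ 4"
  assumes "a \<ge> 2" and "b \<ge> 2"
    and "k_R.subspace U" and "U \<subseteq> bigraded_piece a b" and "k_R.dim U = 4"
    and "inj (($) p)" and "k_R.independent (range (($) p))" and "k_R.span (range (($) p)) = U"
    and "basepoint_free p"
    and "L \<in> Syz p" and "L \<noteq> 0" and "has_bidegree L 0 1"
  shows "\<exists>S1 S2. S1 \<in> Syz p \<and> has_bidegree S1 a (b - 1) \<and>
      S2 \<in> Syz p \<and> has_bidegree S2 a (b - 1) \<and>
      k_R4.dim {g \<in> R_R4.span {L, S1, S2}. has_bidegree g (2 * a - 1) (b - 1)} = 2 * a * b"
proof -
  let ?u = "X Var_u :: 'k bipoly" and ?v = "X Var_v :: 'k bipoly"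
  obtain b' where b: "b = Suc b'" using \<open>b \<ge> 2\<close> by (cases b) auto
  have p_deg: "p $ i \<in> bigraded_piece a (Suc b')" for i
    using k_R.span_base[of "p $ i" "range (($) p)"] assms(4,8) b by auto
  have const_zero: "(\<And>i. C i = 0)" if "(\<Sum>i\<in>UNIV. const_bipoly (C i) * p $ i) = 0" for C
    using const_combination_zero[OF assms(6,7) that] .
  have "\<exists>x y. L $ i = const_bipoly x * ?u + const_bipoly y * ?v" for i
  proof -
    have "L $ i \<in> bigraded_piece 0 (Suc 0)" using assms(12) by (simp add: has_bidegree_def)
    then obtain \<alpha> \<beta> where "L $ i = ?u * \<alpha> + ?v * \<beta>"
      and "\<alpha> \<in> bigraded_piece 0 0" and "\<beta> \<in> bigraded_piece 0 0"
      by (rule decompose_u_v)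
    then show ?thesis by (metis bigraded_piece_0_0D mult.commute)
  qed
  then obtain A' B' where L': "\<And>i. L $ i = const_bipoly (A' i) * ?u + const_bipoly (B' i) * ?v"
    by metis
  define A B where "A i = const_bipoly (A' i)" and "B i = const_bipoly (B' i)" for i
  have L: "L $ i = A i * ?u + B i * ?v" for i by (simp add: L' A_def B_def)
  define q r where "q = (\<Sum>i\<in>UNIV. A i * p $ i)" and "r = (\<Sum>i\<in>UNIV. B i * p $ i)"
  have A0: "A i = 0" if "q = 0" for i
    using const_zero[of A'] that by (simp add: A_def q_def)
  have B0: "B i = 0" if "r = 0" for i
    using const_zero[of B'] that by (simp add: B_def r_def)
  have Lp: "(\<Sum>i\<in>UNIV. L $ i * p $ i) = 0" using assms(10) by (simp add: Syz_def)
  obtain n where n: "L $ n \<noteq> 0" using \<open>L \<noteq> 0\<close> by (auto simp: vec_eq_iff)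
  \<comment> \<open>If all minors of \<open>(A, B)\<close> vanished, then \<open>A\<close> and \<open>B\<close> would be proportional to \<open>L\<close>, so the
    syzygy \<open>L\<close> would make \<open>A\<close> and \<open>B\<close> constant syzygies, contradicting independence of the \<open>p_i\<close>.\<close>
  obtain k l where minor: "A k * B l \<noteq> A l * B k"
  proof (rule ccontr)
    assume "\<not> thesis"
    then have minors: "A i * B j = A j * B i" for i j using that by blast
    have "A n * L $ i = L $ n * A i" "B n * L $ i = L $ n * B i" for i
      using minors[of n i] unfolding L by (algebra, algebra)
    then have "L $ n * q = A n * (\<Sum>i\<in>UNIV. L $ i * p $ i)"
      "L $ n * r = B n * (\<Sum>i\<in>UNIV. L $ i * p $ i)"
      unfolding q_def r_def sum_distrib_left by (simp_all flip: mult.assoc)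
    then have "q = 0" "r = 0" using Lp n by simp_all
    then show False using n A0 B0 L by simp
  qed
  have "q \<in> bigraded_piece a (Suc b')"
    unfolding q_def A_def
    using bigraded_piece_mult[OF const_in_bigraded_piece p_deg] by (intro bigraded_piece_sum) simp
  moreover have "?u * q + ?v * r = 0"
    using Lp unfolding q_def r_def L sum_distrib_left sum.distrib[symmetric]
    by (simp add: algebra_simps)
  ultimately obtain h where q: "q = ?v * h" and r: "r = - (?u * h)" and h: "h \<in> bigraded_piece a b'"
    by (rule syzygy_u_v)
  have "h \<noteq> 0" using minor A0 q by auto
  have "\<exists>\<alpha> \<beta>. p $ i = ?u * \<alpha> + ?v * \<beta> \<and> \<alpha> \<in> bigraded_piece a b' \<and> \<beta> \<in> bigraded_piece a b'" for i
    using decompose_u_v[OF p_deg] by metis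
  then obtain \<alpha> \<beta> where p_eq: "\<And>i. p $ i = ?u * \<alpha> i + ?v * \<beta> i"
    and \<alpha>: "\<And>i. \<alpha> i \<in> bigraded_piece a b'" and \<beta>: "\<And>i. \<beta> i \<in> bigraded_piece a b'"
    by metis
  define S where "S i = (\<chi> n. (if n = i then h else 0) - \<beta> i * A n + \<alpha> i * B n)" for i
  have S_syz: "S i \<in> Syz p" for i
  proof -
    have "(\<Sum>n\<in>UNIV. S i $ n * p $ n) =
        (\<Sum>n\<in>UNIV. (if n = i then h * p $ n else 0)) - \<beta> i * q + \<alpha> i * r"
      unfolding q_def r_def sum_distrib_left sum_subtractf[symmetric] sum.distrib[symmetric]
      by (intro sum.cong refl) (auto simp: S_def algebra_simps)
    also have "\<dots> = h * p $ i - \<beta> i * q + \<alpha> i * r" by simp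
    also have "\<dots> = 0" unfolding q r p_eq[of i] by (simp add: algebra_simps)
    finally show ?thesis by (simp add: Syz_def)
  qed
  have S_deg: "has_bidegree (S i) a b'" for i
  proof -
    have "f * C \<in> bigraded_piece a b'"
      if "f \<in> bigraded_piece a b'" "C \<in> bigraded_piece 0 0" for f C :: "'k bipoly"
      using bigraded_piece_mult[OF that] by simp
    moreover have "A n \<in> bigraded_piece 0 0" "B n \<in> bigraded_piece 0 0" for n
      by (simp_all add: A_def B_def const_in_bigraded_piece)
    ultimately show ?thesis
      unfolding has_bidegree_def S_def
      using h \<alpha> \<beta> by (auto intro!: bigraded_piece_add bigraded_piece_diff)
  qed
  have "k \<noteq> l" using minor by auto
  then have "card (UNIV - {k, l}) = 2" by (simp add: card_Diff_subset)
  then obtain i j where ij: "UNIV - {k, l} = {i, j}" "i \<noteq> j" by (auto simp: card_2_iff)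
  have free: "x = 0 \<and> y = 0 \<and> z = 0" if "x *s L + y *s S i + z *s S j = 0" for x y z
    by (rule free_syzygies[OF \<open>k \<noteq> l\<close> ij(2,1) minor \<open>h \<noteq> 0\<close>, where u = ?u and v = ?v and \<alpha> = \<alpha> and \<beta> = \<beta>])
      (use that in \<open>simp_all add: vec_eq_iff L S_def\<close>)
  have distinct: "L \<noteq> S i" "L \<noteq> S j" "S i \<noteq> S j"
    using free[of 1 "-1" 0] free[of 1 0 "-1"] free[of 0 1 "-1"] by auto
  have indep: "R_R4.independent {L, S i, S j}"
  proof
    assume "R_R4.dependent {L, S i, S j}"
    then obtain w where w: "(\<Sum>G\<in>{L, S i, S j}. w G *s G) = 0"
      and "w L \<noteq> 0 \<or> w (S i) \<noteq> 0 \<or> w (S j) \<noteq> 0"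
      by (auto simp: R_R4.dependent_finite)
    moreover have "w L *s L + w (S i) *s S i + w (S j) *s S j = 0"
      using w distinct by (simp add: add.assoc)
    ultimately show False using free by blast
  qed
  \<comment> \<open>The generators are indexed by themselves, so their bidegrees are functions that single out \<open>L\<close>.\<close>
  define dc dd where "dc G = (if G = L then 0 else a)" and "dd G = (if G = L then 1 else b')" for G
  have "k_R4.dim {g \<in> R_R4.span {L, S i, S j}. has_bidegree g (2 * a - 1) b'} =
      (\<Sum>G\<in>{L, S i, S j}. (2 * a - 1 - dc G + 1) * (b' - dd G + 1))"
    by (rule dim_graded_piece_free[OF _ _ _ indep])
      (use assms(1,2,12) b S_deg in \<open>auto simp: dc_def dd_def\<close>)
  also have "\<dots> = 2 * a * b"
  proof -
    obtain b'' where "b' = Suc b''" using \<open>b \<ge> 2\<close> b by (cases b') auto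
    moreover obtain a' where "a = Suc a'" using \<open>a \<ge> 2\<close> by (cases a) auto
    ultimately show ?thesis
      using distinct distinct[symmetric] b by (simp add: dc_def dd_def algebra_simps)
  qed
  finally show ?thesis using S_syz S_deg b by (intro exI[of _ "S i"] exI[of _ "S j"]) simp
qed

end
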